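(* Let $\alpha>1$ be a real number. Every $\alpha$-balanced digraph has chromatic number at most $\lceil\alpha\rceil+1$.
   Context: A digraph is a pair $\mathcal{G}=(V,E)$ with $E\subseteq V^2$ and no edge of the form $(v,v)$; its chromatic number is the least $\chi$ such that there is a map $c:V\to[\chi]$ with $c(a)\ne c(b)$ for every $(a,b)\in E$. A cycle of $\mathcal{G}$ is a closed walk $c=(v_0,e_1,v_1,\dots,e_n,v_n)$ with $v_n=v_0$, $e_i\in E$, and $\{v_{i-1},v_i\}$ being the two endpoints of $e_i$; the step $i$ is a forward edge if $e_i=(v_{i-1},v_i)$ and a backward edge if $e_i=(v_i,v_{i-1})$. A digraph is $\alpha$-balanced if every cycle of positive length which has $k$ forward edges has strictly fewer than $\alpha k$ backward edges. *)

theory Defs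
  imports Complex_Main "HOL-Library.Extended_Nat" "HOL-Library.FuncSet"
    "Graph_Theory.Pair_Digraph"
begin

definition proper_colouring :: "'a pair_pre_digraph \<Rightarrow> nat \<Rightarrow> ('a \<Rightarrow> nat) \<Rightarrow> bool" where
  "proper_colouring G k c \<longleftrightarrow>
     c \<in> pverts G \<rightarrow> {1..k} \<and> (\<forall>(a, b) \<in> parcs G. c a \<noteq> c b)"

text \<open>
  Digraphs may be infinite. The infimum is taken in \<^typ>\<open>enat\<close>, so it is the least number
  of colours if a finite colouring exists, and \<open>\<infinity>\<close> otherwise.
\<close>
definition chromatic_number :: "'a pair_pre_digraph \<Rightarrow> enat" where
  "chromatic_number G = Inf {enat k | k. \<exists>c. proper_colouring G k c}"

text \<open>
  The walk \<open>(v\<^sub>0, e\<^sub>1, v\<^sub>1, \<dots>, e\<^sub>n, v\<^sub>n)\<close> is given by the lists \<open>vs = [v\<^sub>0, \<dots>, v\<^sub>n]\<close> and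
  \<open>es = [e\<^sub>1, \<dots>, e\<^sub>n]\<close>; thus \<open>e\<^sub>i\<close> is \<open>es ! (i - 1)\<close>. Edges may be traversed against
  their direction, and neither vertices nor edges need be distinct.
\<close>
definition closed_walk :: "'a pair_pre_digraph \<Rightarrow> 'a list \<Rightarrow> ('a \<times> 'a) list \<Rightarrow> bool" where
  "closed_walk G vs es \<longleftrightarrow>
     length vs = length es + 1 \<and> set vs \<subseteq> pverts G \<and> set es \<subseteq> parcs G \<and>
     (\<forall>i < length es. es ! i = (vs ! i, vs ! (i + 1)) \<or> es ! i = (vs ! (i + 1), vs ! i)) \<and>
     vs ! length es = vs ! 0"

definition num_forward :: "'a list \<Rightarrow> ('a \<times> 'a) list \<Rightarrow> nat" where
  "num_forward vs es = card {i. i < length es \<and> es ! i = (vs ! i, vs ! (i + 1))}"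

definition num_backward :: "'a list \<Rightarrow> ('a \<times> 'a) list \<Rightarrow> nat" where
  "num_backward vs es = card {i. i < length es \<and> es ! i = (vs ! (i + 1), vs ! i)}"

definition balanced :: "real \<Rightarrow> 'a pair_pre_digraph \<Rightarrow> bool" where
  "balanced \<alpha> G \<longleftrightarrow>
     (\<forall>vs es. closed_walk G vs es \<and> length es > 0 \<longrightarrow>
        real (num_backward vs es) < \<alpha> * real (num_forward vs es))"

end

theory Submission
  imports Defs
begin

text \<open>
  Put \<open>n = \<lceil>\<alpha>\<rceil>\<close> and give a step of a walk weight \<open>n\<close> if it is forward and \<open>-1\<close> if it is
  backward. Balancedness says that closed walks have nonnegative weight, so the least weight
  \<open>d v\<close> of a walk from \<open>v\<close> to a root of its component exists, and \<open>1 \<le> d a - d b \<le> n\<close> for every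
  edge \<open>(a, b)\<close>. Hence \<open>d\<close> modulo \<open>n + 1\<close> is a proper colouring.
\<close>

inductive weighted_walk :: "'a pair_pre_digraph \<Rightarrow> int \<Rightarrow> 'a \<Rightarrow> int \<Rightarrow> 'a \<Rightarrow> bool"
  for G n where
  refl: "u \<in> pverts G \<Longrightarrow> weighted_walk G n u 0 u"
| forward: "(u, v) \<in> parcs G \<Longrightarrow> weighted_walk G n v w x \<Longrightarrow> weighted_walk G n u (w + n) x"
| backward: "(v, u) \<in> parcs G \<Longrightarrow> weighted_walk G n v w x \<Longrightarrow> weighted_walk G n u (w - 1) x"

text \<open>Splitting off index 0 lets the index-based step counts be computed recursively when a
  step is prepended to a walk.\<close>

lemma card_less_Suc_shift:
  "card {i. i < Suc m \<and> P i} = (if P 0 then 1 else 0) + card {i. i < m \<and> P (Suc i)}"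
proof -
  have "{i. i < Suc m \<and> P i} = (if P 0 then {0} else {}) \<union> Suc ` {i. i < m \<and> P (Suc i)}"
    by (auto simp: image_iff less_Suc_eq_0_disj)
  then show ?thesis
    by (simp add: card_image)
qed

lemma num_forward_Cons:
  "num_forward (u # vs) (e # es) = (if e = (u, vs ! 0) then 1 else 0) + num_forward vs es"
  unfolding num_forward_def by (simp add: card_less_Suc_shift)

lemma num_backward_Cons:
  "num_backward (u # vs) (e # es) = (if e = (vs ! 0, u) then 1 else 0) + num_backward vs es"
  unfolding num_backward_def by (simp add: card_less_Suc_shift)

context pair_loopfree_digraph
begin

text \<open>Bridge from inductive walks, which are easy to concatenate, to the list walks that
  \<open>balanced\<close> speaks of. Each rule prepends one vertex and one arc.\<close>

lemma weighted_walk_lists: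
  assumes "weighted_walk G n u w v"
  shows "\<exists>vs es. length vs = length es + 1 \<and> set vs \<subseteq> pverts G \<and> set es \<subseteq> parcs G \<and>
     (\<forall>i < length es. es ! i = (vs ! i, vs ! (i + 1)) \<or> es ! i = (vs ! (i + 1), vs ! i)) \<and>
     vs ! 0 = u \<and> vs ! length es = v \<and>
     w = n * int (num_forward vs es) - int (num_backward vs es)"
  using assms
proof induction
  case (refl u)
  then show ?case
    by (intro exI[of _ "[u]"] exI[of _ "[]"]) (simp add: num_forward_def num_backward_def)
next
  case (forward u v w x)
  then obtain vs es where *: "length vs = length es + 1" "set vs \<subseteq> pverts G" "set es \<subseteq> parcs G"
    "\<forall>i < length es. es ! i = (vs ! i, vs ! (i + 1)) \<or> es ! i = (vs ! (i + 1), vs ! i)"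
    "vs ! 0 = v" "vs ! length es = x" "w = n * int (num_forward vs es) - int (num_backward vs es)"
    by blast
  \<comment> \<open>A loop would count as forward and backward at once; \<open>u \<noteq> v\<close>
    makes the new step change exactly one of the two counts.\<close>
  have "u \<noteq> v" "u \<in> pverts G"
    using no_loops[OF forward.hyps(1)] in_arcsD1[OF forward.hyps(1)] by auto
  with * forward.hyps(1) show ?case
    by (intro exI[of _ "u # vs"] exI[of _ "(u, v) # es"])
      (auto simp: num_forward_Cons num_backward_Cons less_Suc_eq_0_disj algebra_simps)
next
  case (backward v u w x)
  then obtain vs es where *: "length vs = length es + 1" "set vs \<subseteq> pverts G" "set es \<subseteq> parcs G"
    "\<forall>i < length es. es ! i = (vs ! i, vs ! (i + 1)) \<or> es ! i = (vs ! (i + 1), vs ! i)"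
    "vs ! 0 = v" "vs ! length es = x" "w = n * int (num_forward vs es) - int (num_backward vs es)"
    by blast
  have "u \<noteq> v" "u \<in> pverts G"
    using no_loops[OF backward.hyps(1)] in_arcsD2[OF backward.hyps(1)] by auto
  with * backward.hyps(1) show ?case
    by (intro exI[of _ "u # vs"] exI[of _ "(v, u) # es"])
      (auto simp: num_forward_Cons num_backward_Cons less_Suc_eq_0_disj algebra_simps)
qed

text \<open>Rounding \<alpha> up only raises the weight of forward steps, so the bound from
  balancedness survives. The empty walk, about which \<open>balanced\<close> says nothing, has
  weight 0.\<close>

lemma weighted_walk_closed_nonneg:
  assumes "balanced \<alpha> G" and "weighted_walk G \<lceil>\<alpha>\<rceil> u w u"
  shows "0 \<le> w"
proof -
  obtain vs es where *: "closed_walk G vs es"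
    and w: "w = \<lceil>\<alpha>\<rceil> * int (num_forward vs es) - int (num_backward vs es)"
    using weighted_walk_lists[OF assms(2)] unfolding closed_walk_def by metis
  show ?thesis
  proof (cases "es = []")
    case True
    then show ?thesis
      by (simp add: w num_forward_def num_backward_def)
  next
    case False
    then have "real (num_backward vs es) < \<alpha> * real (num_forward vs es)"
      using assms(1) * unfolding balanced_def by blast
    also have "\<dots> \<le> real_of_int \<lceil>\<alpha>\<rceil> * real (num_forward vs es)"
      by (intro mult_right_mono) auto
    finally have "real_of_int (int (num_backward vs es)) < real_of_int (\<lceil>\<alpha>\<rceil> * int (num_forward vs es))"
      by simp
    then show ?thesis
      unfolding w of_int_less_iff by simp
  qed
qed

lemma weighted_walk_trans:
  assumes "weighted_walk G n u w v" and "weighted_walk G n v w' x"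
  shows "weighted_walk G n u (w + w') x"
  using assms
proof induction
  case (forward u v w x)
  then show ?case
    using weighted_walk.forward[of u v G n "w + w'" _] by (simp add: algebra_simps)
next
  case (backward v u w x)
  then show ?case
    using weighted_walk.backward[of v u G n "w + w'" _] by (simp add: algebra_simps)
qed simp

lemma weighted_walk_arc:
  assumes "(a, b) \<in> parcs G"
  shows "weighted_walk G n a n b" and "weighted_walk G n b (-1) a"
  using weighted_walk.forward[OF assms weighted_walk.refl[OF in_arcsD2[OF assms]], of n]
    weighted_walk.backward[OF assms weighted_walk.refl[OF in_arcsD1[OF assms]], of n]
  by simp_all

text \<open>Reversal swaps the step weights \<open>n\<close> and \<open>-1\<close>, so the new
  weight is not determined by \<open>w\<close>; only the existence of a return walk matters.\<close>

lemma weighted_walk_sym: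
  assumes "weighted_walk G n u w v"
  shows "\<exists>w'. weighted_walk G n v w' u"
  using assms
proof induction
  case (refl u)
  then show ?case
    by (auto intro: weighted_walk.refl)
qed (meson weighted_walk_arc weighted_walk_trans)+

lemma weighted_walk_potential:
  assumes nonneg: "\<And>u w. weighted_walk G n u w u \<Longrightarrow> 0 \<le> w"
  shows "\<exists>d :: 'a \<Rightarrow> int. \<forall>(a, b) \<in> parcs G. 1 \<le> d a - d b \<and> d a - d b \<le> n"
proof -
  \<comment> \<open>The choice depends only on the set of vertices reachable from \<open>v\<close>,
    so it picks one root per component.\<close>
  define root where "root v = (SOME r. \<exists>w. weighted_walk G n v w r)" for v
  define W where "W v = {w. weighted_walk G n v w (root v)}" for v
  have root_walk: "W v \<noteq> {}" if "v \<in> pverts G" for v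
    using someI_ex[of "\<lambda>r. \<exists>w. weighted_walk G n v w r"] weighted_walk.refl[OF that]
    unfolding W_def root_def by blast
  \<comment> \<open>One fixed return walk of weight \<open>w0\<close> closes every walk from
    \<open>v\<close> to its root, so all their weights are at least \<open>- w0\<close>.\<close>
  have bdd: "bdd_below (W v)" if v: "v \<in> pverts G" for v
  proof -
    obtain w0 where w0: "weighted_walk G n (root v) w0 v"
      using root_walk[OF v] weighted_walk_sym unfolding W_def by blast
    have "- w0 \<le> w" if "w \<in> W v" for w
      using nonneg[OF weighted_walk_trans[OF _ w0]] that unfolding W_def by force
    then show ?thesis
      by (rule bdd_belowI)
  qed
  have root_eq: "root a = root b" if "(a, b) \<in> parcs G" for a b
  proof -
    have "(\<exists>w. weighted_walk G n a w r) \<longleftrightarrow> (\<exists>w. weighted_walk G n b w r)" for r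
      using weighted_walk_arc[OF that] weighted_walk_trans by blast
    then show ?thesis
      unfolding root_def by simp
  qed
  \<comment> \<open>Triangle inequality: prefixing the walk of weight \<open>k\<close> turns each
    walk from \<open>v\<close> to the common root into one from \<open>u\<close>.\<close>
  have Inf_le: "Inf (W u) \<le> k + Inf (W v)"
    if "weighted_walk G n u k v" "root u = root v" "u \<in> pverts G" "v \<in> pverts G" for u v k
  proof -
    have "Inf (W u) - k \<le> w" if w: "w \<in> W v" for w
    proof -
      have "k + w \<in> W u"
        using weighted_walk_trans[OF \<open>weighted_walk G n u k v\<close>] w \<open>root u = root v\<close>
        unfolding W_def by simp
      then show ?thesis
        using cInf_lower[OF _ bdd[OF \<open>u \<in> pverts G\<close>]] by fastforce
    qed
    then have "Inf (W u) - k \<le> Inf (W v)"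
      by (intro cInf_greatest root_walk that)
    then show ?thesis
      by simp
  qed
  \<comment> \<open>Traversing the arc forward (\<open>k = n\<close>) gives the upper bound,
    traversing it backward (\<open>k = -1\<close>) the lower one.\<close>
  have "1 \<le> Inf (W a) - Inf (W b) \<and> Inf (W a) - Inf (W b) \<le> n" if "(a, b) \<in> parcs G" for a b
    using Inf_le[OF weighted_walk_arc(1)[OF that]] Inf_le[OF weighted_walk_arc(2)[OF that]]
      root_eq[OF that] in_arcsD1[OF that] in_arcsD2[OF that] by simp
  then show ?thesis
    by (intro exI[of _ "\<lambda>v. Inf (W v)"]) auto
qed

end

text \<open>Along an arc the potential drops by an amount strictly between 0 and
  \<open>n + 1\<close>, hence not by a multiple of \<open>n + 1\<close>. Adding 1 moves the residues
  into \<open>{1..n + 1}\<close>.\<close>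

lemma proper_colouring_of_potential:
  fixes d :: "'a \<Rightarrow> int"
  assumes d: "\<forall>(a, b) \<in> parcs G. 1 \<le> d a - d b \<and> d a - d b \<le> n" and "0 \<le> n"
  shows "proper_colouring G (nat n + 1) (\<lambda>v. nat (d v mod (n + 1)) + 1)"
proof -
  have "nat (d v mod (n + 1)) \<le> nat n" for v
    using pos_mod_bound[of "n + 1" "d v"] \<open>0 \<le> n\<close> by (intro nat_mono) simp
  moreover have "nat (d a mod (n + 1)) \<noteq> nat (d b mod (n + 1))" if "(a, b) \<in> parcs G" for a b
  proof
    assume "nat (d a mod (n + 1)) = nat (d b mod (n + 1))"
    then have "d a mod (n + 1) = d b mod (n + 1)"
      using \<open>0 \<le> n\<close> by (simp add: eq_nat_nat_iff)
    then have "n + 1 dvd d a - d b"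
      by (simp add: mod_eq_dvd_iff)
    moreover have "1 \<le> d a - d b" "d a - d b \<le> n"
      using d that by auto
    ultimately show False
      using zdvd_imp_le[of "n + 1" "d a - d b"] by simp
  qed
  ultimately show ?thesis
    unfolding proper_colouring_def by auto
qed

theorem theorem2:
  fixes \<alpha> :: real and G :: "'a pair_pre_digraph"
  assumes "\<alpha> > 1"
    and "pair_loopfree_digraph G"
    and "balanced \<alpha> G"
  shows "chromatic_number G \<le> enat (nat \<lceil>\<alpha>\<rceil> + 1)"
proof -
  interpret pair_loopfree_digraph G
    by fact
  obtain d :: "'a \<Rightarrow> int"
    where "\<forall>(a, b) \<in> parcs G. 1 \<le> d a - d b \<and> d a - d b \<le> \<lceil>\<alpha>\<rceil>"
    using weighted_walk_potential[of "\<lceil>\<alpha>\<rceil>"] weighted_walk_closed_nonneg[OF assms(3)] by blast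
  moreover have "0 \<le> \<lceil>\<alpha>\<rceil>"
    using assms(1) by linarith
  ultimately show ?thesis
    using proper_colouring_of_potential unfolding chromatic_number_def
    by (intro Inf_lower) blast
qed

end
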